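(* There exists an algorithm that takes as input a graph $G$, a finite family $\mathcal{H}=\{H_j\}_{j\in J}$ of connected nonnull subgraphs of $G$, and a tree decomposition $\mathcal{T}=(T,\{X_t\}_{t\in V(T)})$ of $G$, and computes in time $$\mathcal{O}\Big(|J|\cdot\big((|J|+|V(T)|)\cdot|V(G)|+|E(G)|\big)\Big)$$ the graph $G(\mathcal{H})$ and a tree decomposition $\mathcal{T}'=(T,\{X'_t\}_{t\in V(T)})$ of $G(\mathcal{H})$ (with the same tree $T$) such that $\alpha(\mathcal{T}')\le\alpha(\mathcal{T})$.
   Context: All graphs are finite, simple, and undirected; a graph is nonnull if it has at least one vertex. For a graph $G$ and a family $\mathcal{H}=\{H_j\}_{j\in J}$ of connected subgraphs of $G$, the graph $G(\mathcal{H})$ has vertex set $J$, and two distinct elements $i,j\in J$ are adjacent if and only if $H_i$ and $H_j$ have a vertex in common or there is an edge of $G$ with one endpoint in $H_i$ and the other in $H_j$. A tree decomposition of a graph $G$ is a pair $\mathcal{T}=(T,\{X_t\}_{t\in V(T)})$ where $T$ is a tree and each node $t$ is assigned a bag $X_t\subseteq V(G)$ such that every vertex of $G$ is in at least one bag, every edge of $G$ has both endpoints in some common bag, and for every $u\in V(G)$ the subgraph of $T$ induced by $\{t: u\in X_t\}$ is connected. The independence number of a tree decomposition $\mathcal{T}$ of $G$ is $\alpha(\mathcal{T})=\max_{t\in V(T)}\alpha(G[X_t])$, where $\alpha(H)$ is the maximum size of an independent set in $H$. *)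

theory Defs
  imports Main
begin

section \<open>Finite simple undirected graphs\<close>

record 'a ugraph =
  verts :: "'a set"
  edges :: "'a set set"

definition simple_graph :: "'a ugraph \<Rightarrow> bool" where
  "simple_graph G \<longleftrightarrow>
     finite (verts G) \<and> (\<forall>e\<in>edges G. e \<subseteq> verts G \<and> card e = 2)"

definition nonnull :: "'a ugraph \<Rightarrow> bool" where
  "nonnull G \<longleftrightarrow> verts G \<noteq> {}"

definition subgraph :: "'a ugraph \<Rightarrow> 'a ugraph \<Rightarrow> bool" where
  "subgraph H G \<longleftrightarrow> simple_graph H \<and> verts H \<subseteq> verts G \<and> edges H \<subseteq> edges G"

definition induced_subgraph :: "'a ugraph \<Rightarrow> 'a set \<Rightarrow> 'a ugraph" where
  "induced_subgraph G S = \<lparr>verts = verts G \<inter> S, edges = {e \<in> edges G. e \<subseteq> S}\<rparr>"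

(* The null graph counts as connected. *)
definition connected_graph :: "'a ugraph \<Rightarrow> bool" where
  "connected_graph G \<longleftrightarrow>
     (\<forall>u\<in>verts G. \<forall>v\<in>verts G. (u, v) \<in> {(x, y). {x, y} \<in> edges G}\<^sup>*)"

definition graph_cycle :: "'a ugraph \<Rightarrow> 'a list \<Rightarrow> bool" where
  "graph_cycle G xs \<longleftrightarrow> 3 \<le> length xs \<and> distinct xs \<and>
     (\<forall>i<length xs. {xs ! i, xs ! (Suc i mod length xs)} \<in> edges G)"

definition tree :: "'a ugraph \<Rightarrow> bool" where
  "tree T \<longleftrightarrow> simple_graph T \<and> nonnull T \<and> connected_graph T \<and> (\<nexists>xs. graph_cycle T xs)"

definition independent :: "'a ugraph \<Rightarrow> 'a set \<Rightarrow> bool" where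
  "independent G S \<longleftrightarrow> S \<subseteq> verts G \<and> (\<forall>u\<in>S. \<forall>v\<in>S. {u, v} \<notin> edges G)"

definition independence_number :: "'a ugraph \<Rightarrow> nat" where
  "independence_number G = Max {card S | S. independent G S}"


section \<open>Tree decompositions and the graph of a family of subgraphs\<close>

definition tree_decomposition :: "'a ugraph \<Rightarrow> 't ugraph \<Rightarrow> ('t \<Rightarrow> 'a set) \<Rightarrow> bool" where
  "tree_decomposition G T X \<longleftrightarrow>
     tree T \<and>
     (\<forall>t\<in>verts T. X t \<subseteq> verts G) \<and>
     (\<forall>u\<in>verts G. \<exists>t\<in>verts T. u \<in> X t) \<and>
     (\<forall>e\<in>edges G. \<exists>t\<in>verts T. e \<subseteq> X t) \<and>
     (\<forall>u\<in>verts G. connected_graph (induced_subgraph T {t \<in> verts T. u \<in> X t}))"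

definition td_independence_number :: "'a ugraph \<Rightarrow> 't ugraph \<Rightarrow> ('t \<Rightarrow> 'a set) \<Rightarrow> nat" where
  "td_independence_number G T X =
     Max ((\<lambda>t. independence_number (induced_subgraph G (X t))) ` verts T)"

definition family_graph :: "'a ugraph \<Rightarrow> 'j set \<Rightarrow> ('j \<Rightarrow> 'a ugraph) \<Rightarrow> 'j ugraph" where
  "family_graph G J H =
     \<lparr>verts = J,
      edges = {{i, j} | i j. i \<in> J \<and> j \<in> J \<and> i \<noteq> j \<and>
        (verts (H i) \<inter> verts (H j) \<noteq> {} \<or>
         (\<exists>u\<in>verts (H i). \<exists>v\<in>verts (H j). {u, v} \<in> edges G))}\<rparr>"


section \<open>The machine model\<close>

text \<open>
  Programs for a random access machine with registers and arrays that hold natural numbers.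
  A program mentions only finitely many registers and arrays; array cells are addressed
  indirectly through a register. Every instruction and every test takes one unit of time.
  As the only arithmetic operations are successor and predecessor, the largest stored number
  grows by at most one per step (beyond the constants of the program), so that unit
  cost does not hide computation with huge numbers.
\<close>

record state =
  reg :: "nat \<Rightarrow> nat"
  arr :: "nat \<Rightarrow> nat \<Rightarrow> nat"

datatype com =
    Skip
  | Const nat nat
  | Copy nat nat
  | Inc nat
  | Dec nat
  | Load nat nat nat
  | Store nat nat nat
  | Seq com com
  | IfLess nat nat com com
  | WhileLess nat nat com

definition set_reg :: "nat \<Rightarrow> nat \<Rightarrow> state \<Rightarrow> state" where
  "set_reg r x s = s\<lparr>reg := (reg s)(r := x)\<rparr>"

definition set_arr :: "nat \<Rightarrow> nat \<Rightarrow> nat \<Rightarrow> state \<Rightarrow> state" where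
  "set_arr a i x s = s\<lparr>arr := (arr s)(a := (arr s a)(i := x))\<rparr>"

(* exec c s n s': started in s, the program c halts in s' after exactly n time units. *)
inductive exec :: "com \<Rightarrow> state \<Rightarrow> nat \<Rightarrow> state \<Rightarrow> bool" where
  Skip: "exec Skip s 1 s"
| Const: "exec (Const r k) s 1 (set_reg r k s)"
| Copy: "exec (Copy r q) s 1 (set_reg r (reg s q) s)"
| Inc: "exec (Inc r) s 1 (set_reg r (reg s r + 1) s)"
| Dec: "exec (Dec r) s 1 (set_reg r (reg s r - 1) s)"
| Load: "exec (Load r a i) s 1 (set_reg r (arr s a (reg s i)) s)"
| Store: "exec (Store a i r) s 1 (set_arr a (reg s i) (reg s r) s)"
| Seq: "exec c s m s' \<Longrightarrow> exec d s' n s'' \<Longrightarrow> exec (Seq c d) s (m + n) s''"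
| IfTrue: "reg s r < reg s q \<Longrightarrow> exec c s n s' \<Longrightarrow> exec (IfLess r q c d) s (1 + n) s'"
| IfFalse: "\<not> reg s r < reg s q \<Longrightarrow> exec d s n s' \<Longrightarrow> exec (IfLess r q c d) s (1 + n) s'"
| WhileFalse: "\<not> reg s r < reg s q \<Longrightarrow> exec (WhileLess r q c) s 1 s"
| WhileTrue: "reg s r < reg s q \<Longrightarrow> exec c s m s' \<Longrightarrow> exec (WhileLess r q c) s' n s'' \<Longrightarrow>
    exec (WhileLess r q c) s (1 + m + n) s''"

inductive_cases exec_cases:
  "exec Skip s n s'" "exec (Const r k) s n s'" "exec (Copy r q) s n s'" "exec (Inc r) s n s'"
  "exec (Dec r) s n s'" "exec (Load r a i) s n s'" "exec (Store a i r) s n s'"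
  "exec (Seq c d) s n s'" "exec (IfLess r q c d) s n s'" "exec (WhileLess r q c) s n s'"

lemma exec_deterministic:
  "exec c s n s' \<Longrightarrow> exec c s m s'' \<Longrightarrow> m = n \<and> s'' = s'"
proof (induction arbitrary: m s'' rule: exec.induct)
  case (Seq c s k s' d n t)
  from Seq.prems obtain k' n' u where "exec c s k' u" "exec d u n' s''" "m = k' + n'"
    by (rule exec_cases)
  with Seq.IH(1)[of k' u] Seq.IH(2)[of n' s''] show ?case by simp
next
  case (IfTrue s r q c n s' d)
  note IH = IfTrue.IH and less = IfTrue.hyps(1)
  from IfTrue.prems show ?case
  proof cases
    case (IfTrue n')
    with IH[of n' s''] show ?thesis by simp
  qed (use less in simp)
next
  case (IfFalse s r q d n s' c)
  note IH = IfFalse.IH and less = IfFalse.hyps(1)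
  from IfFalse.prems show ?case
  proof cases
    case (IfFalse n')
    with IH[of n' s''] show ?thesis by simp
  qed (use less in simp)
next
  case (WhileFalse s r q c)
  from WhileFalse.prems WhileFalse.hyps show ?case by cases simp_all
next
  case (WhileTrue s r q c k s' n t)
  note IH = WhileTrue.IH and less = WhileTrue.hyps(1)
  from WhileTrue.prems show ?case
  proof cases
    case (WhileTrue k' u n')
    with IH(1)[of k' u] IH(2)[of n' s''] show ?thesis by simp
  qed (use less in simp)
qed (erule exec_cases; simp)+


section \<open>Representation of the input and the output\<close>

(* Graphs are stored as edge lists without repetitions over the vertices 0, ..., n - 1, with
   register rn holding n, register rm the number of edges and arrays a, b the endpoints. *)
definition graph_at :: "state \<Rightarrow> nat \<Rightarrow> nat \<Rightarrow> nat \<Rightarrow> nat \<Rightarrow> nat ugraph \<Rightarrow> bool" where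
  "graph_at s rn rm a b G \<longleftrightarrow>
     verts G = {..<reg s rn} \<and>
     bij_betw (\<lambda>e. {arr s a e, arr s b e}) {..<reg s rm} (edges G)"

(* A sequence of k lists is stored by concatenation; the i-th list occupies the positions in
   segment s off i, delimited by consecutive entries of the offset array off. *)
definition offsets_at :: "state \<Rightarrow> nat \<Rightarrow> nat \<Rightarrow> bool" where
  "offsets_at s k off \<longleftrightarrow> arr s off 0 = 0 \<and> (\<forall>i<k. arr s off i \<le> arr s off (Suc i))"

definition segment :: "state \<Rightarrow> nat \<Rightarrow> nat \<Rightarrow> nat set" where
  "segment s off i = {arr s off i ..< arr s off (Suc i)}"

definition sets_at :: "state \<Rightarrow> nat \<Rightarrow> nat \<Rightarrow> nat \<Rightarrow> (nat \<Rightarrow> nat set) \<Rightarrow> bool" where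
  "sets_at s k off a F \<longleftrightarrow>
     offsets_at s k off \<and> (\<forall>i<k. bij_betw (arr s a) (segment s off i) (F i))"

definition edge_sets_at ::
  "state \<Rightarrow> nat \<Rightarrow> nat \<Rightarrow> nat \<Rightarrow> nat \<Rightarrow> (nat \<Rightarrow> nat set set) \<Rightarrow> bool" where
  "edge_sets_at s k off a b F \<longleftrightarrow>
     offsets_at s k off \<and>
     (\<forall>i<k. bij_betw (\<lambda>e. {arr s a e, arr s b e}) (segment s off i) (F i))"

(* Memory that does not belong to the input is initially 0. *)
definition input_state ::
  "state \<Rightarrow> nat ugraph \<Rightarrow> nat set \<Rightarrow> (nat \<Rightarrow> nat ugraph) \<Rightarrow> nat ugraph \<Rightarrow> (nat \<Rightarrow> nat set) \<Rightarrow> bool"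
where
  "input_state s G J H T X \<longleftrightarrow>
     graph_at s 0 1 0 1 G \<and>
     J = {..<reg s 2} \<and>
     sets_at s (reg s 2) 2 3 (\<lambda>j. verts (H j)) \<and>
     edge_sets_at s (reg s 2) 4 5 6 (\<lambda>j. edges (H j)) \<and>
     graph_at s 3 4 7 8 T \<and>
     sets_at s (reg s 3) 9 10 X \<and>
     (\<forall>r\<ge>5. reg s r = 0) \<and> (\<forall>a\<ge>11. \<forall>i. arr s a i = 0)"

(* The tree T of the output decomposition is expected where the input provides it. *)
definition output_state ::
  "state \<Rightarrow> nat ugraph \<Rightarrow> nat ugraph \<Rightarrow> (nat \<Rightarrow> nat set) \<Rightarrow> bool" where
  "output_state s G' T X' \<longleftrightarrow>
     graph_at s 5 6 11 12 G' \<and>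
     graph_at s 3 4 7 8 T \<and>
     sets_at s (reg s 3) 13 14 X'"

end

theory Submission
  imports Defs
begin

text \<open>
  The new bag at a node \<open>t\<close> consists of the indices \<open>j\<close> such that \<open>H j\<close> meets \<open>X t\<close>. The nodes
  whose bag contains \<open>j\<close> form a connected set, because walking along an edge \<open>uv\<close> of the connected
  graph \<open>H j\<close> moves from the subtree of \<open>u\<close> to that of \<open>v\<close>, and these two intersect. Picking a vertex
  of \<open>H j\<close> in \<open>X t\<close> for every \<open>j\<close> of an independent set of the new bag gives an independent set of
  the same size in the old one.

  For the running time, mark the closed neighbourhood of \<open>H j\<close> in time \<open>O(|V(G)| + |E(G)|)\<close>; scanning
  all \<open>H i\<close> with \<open>i < j\<close> then finds the neighbours of \<open>j\<close> in time \<open>O(|J| |V(G)|)\<close>. Likewise mark each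
  bag \<open>X t\<close> and scan all \<open>H j\<close>. All terms are absorbed by the bound since \<open>V(G)\<close> and \<open>V(T)\<close> are
  nonempty when \<open>J\<close> is; for empty \<open>J\<close> the initial memory already encodes the output.
\<close>

section \<open>A program logic with time\<close>

text \<open>Total correctness, with a postcondition on both the step count and the final state.
  Since \<open>exec\<close> is deterministic, the one terminating run it asks for is the only
  run.\<close>

definition run :: "com \<Rightarrow> state \<Rightarrow> (nat \<Rightarrow> state \<Rightarrow> bool) \<Rightarrow> bool" where
  "run c s Q \<longleftrightarrow> (\<exists>n s'. exec c s n s' \<and> Q n s')"

fun written_regs :: "com \<Rightarrow> nat set" where
  "written_regs (Const r k) = {r}"
| "written_regs (Copy r q) = {r}"
| "written_regs (Inc r) = {r}"
| "written_regs (Dec r) = {r}"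
| "written_regs (Load r a i) = {r}"
| "written_regs (Seq c d) = written_regs c \<union> written_regs d"
| "written_regs (IfLess r q c d) = written_regs c \<union> written_regs d"
| "written_regs (WhileLess r q c) = written_regs c"
| "written_regs _ = {}"

fun written_arrs :: "com \<Rightarrow> nat set" where
  "written_arrs (Store a i r) = {a}"
| "written_arrs (Seq c d) = written_arrs c \<union> written_arrs d"
| "written_arrs (IfLess r q c d) = written_arrs c \<union> written_arrs d"
| "written_arrs (WhileLess r q c) = written_arrs c"
| "written_arrs _ = {}"

text \<open>A syntactic bound on what can change, at the granularity of whole arrays. It spares the
  loop invariants from listing all that stays fixed.\<close>

definition frame :: "com \<Rightarrow> state \<Rightarrow> state \<Rightarrow> bool" where
  "frame c s s' \<longleftrightarrow>
     (\<forall>r. r \<notin> written_regs c \<longrightarrow> reg s' r = reg s r) \<and>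
     (\<forall>a. a \<notin> written_arrs c \<longrightarrow> arr s' a = arr s a)"

lemma reg_set_reg [simp]: "reg (set_reg r x s) = (reg s)(r := x)"
  and arr_set_reg [simp]: "arr (set_reg r x s) = arr s"
  and reg_set_arr [simp]: "reg (set_arr a i x s) = reg s"
  and arr_set_arr [simp]: "arr (set_arr a i x s) = (arr s)(a := (arr s a)(i := x))"
  by (simp_all add: set_reg_def set_arr_def)

lemma exec_frame: "exec c s n s' \<Longrightarrow> frame c s s'"
  by (induction rule: exec.induct) (auto simp: frame_def)

text \<open>Besides weakening, this supplies the frame of \<open>c\<close> for free, so
  specifications need only mention the memory that \<open>c\<close> writes.\<close>

lemma run_conseq:
  assumes "run c s Q" and "\<And>n s'. Q n s' \<Longrightarrow> frame c s s' \<Longrightarrow> Q' n s'"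
  shows "run c s Q'"
  using assms exec_frame unfolding run_def by blast

lemma run_Skip [simp]: "run Skip s Q \<longleftrightarrow> Q 1 s"
  and run_Const [simp]: "run (Const r k) s Q \<longleftrightarrow> Q 1 (set_reg r k s)"
  and run_Copy [simp]: "run (Copy r q) s Q \<longleftrightarrow> Q 1 (set_reg r (reg s q) s)"
  and run_Inc [simp]: "run (Inc r) s Q \<longleftrightarrow> Q 1 (set_reg r (Suc (reg s r)) s)"
  and run_Load [simp]: "run (Load r a i) s Q \<longleftrightarrow> Q 1 (set_reg r (arr s a (reg s i)) s)"
  and run_Store [simp]: "run (Store a i r) s Q \<longleftrightarrow> Q 1 (set_arr a (reg s i) (reg s r) s)"
  by (auto simp: run_def elim: exec_cases intro: exec.intros[unfolded One_nat_def] exec.Inc[simplified])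

text \<open>Nesting the postconditions adds up the step counts; with this the simplifier executes
  straight-line code symbolically.\<close>

lemma run_Seq [simp]:
  "run (Seq c d) s Q \<longleftrightarrow> run c s (\<lambda>m s'. run d s' (\<lambda>n. Q (m + n)))"
  by (auto simp: run_def elim!: exec_cases(8)) (blast intro: exec.Seq)+

lemma run_IfLess [simp]:
  "run (IfLess r q c d) s Q \<longleftrightarrow>
     (if reg s r < reg s q then run c s (\<lambda>n. Q (1 + n)) else run d s (\<lambda>n. Q (1 + n)))"
proof (cases "reg s r < reg s q")
  case True
  then show ?thesis
    by (auto simp: run_def elim!: exec_cases(9) dest: exec.IfTrue)
      (metis exec.IfTrue plus_1_eq_Suc)
next
  case False
  then show ?thesis
    by (auto simp: run_def elim!: exec_cases(9))
      (metis exec.IfFalse plus_1_eq_Suc)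
qed

lemma run_While_exit: "\<not> reg s r < reg s q \<Longrightarrow> Q 1 s \<Longrightarrow> run (WhileLess r q c) s Q"
  unfolding run_def using exec.WhileFalse by blast

lemma run_While_step:
  "reg s r < reg s q \<Longrightarrow> run c s (\<lambda>m s'. run (WhileLess r q c) s' (\<lambda>n. Q (1 + m + n))) \<Longrightarrow>
   run (WhileLess r q c) s Q"
  unfolding run_def using exec.WhileTrue by blast

abbreviation For :: "nat \<Rightarrow> nat \<Rightarrow> com \<Rightarrow> com" where
  "For i q c \<equiv> WhileLess i q (Seq c (Inc i))"

text \<open>An iteration costs the test, at most \<open>B\<close> steps of the body, and the
  increment; the last, failing test gives the extra 1. As \<open>I k\<close> describes the state in
  which the counter is \<open>k\<close>, the body has to establish \<open>I (Suc k)\<close> for the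
  state after the increment.\<close>

lemma run_For:
  assumes regs: "i \<noteq> q" "i \<notin> written_regs c" "q \<notin> written_regs c"
    and le: "reg s i \<le> reg s q"
    and init: "I (reg s i) s"
    and step: "\<And>k t. \<lbrakk>reg s i \<le> k; k < reg s q; reg t i = k; frame (For i q c) s t; I k t\<rbrakk> \<Longrightarrow>
      run c t (\<lambda>n t'. n \<le> B \<and> I (Suc k) (set_reg i (Suc k) t'))"
  shows "run (For i q c) s (\<lambda>n t. n \<le> 1 + (reg s q - reg s i) * (B + 2) \<and> I (reg s q) t)"
proof -
  \<comment> \<open>Induction on the number \<open>d\<close> of remaining iterations, for all states
    \<open>t\<close> within the frame of the loop.\<close>
  have "run (For i q c) t (\<lambda>n t'. n \<le> 1 + d * (B + 2) \<and> I (reg s q) t')"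
    if "reg s q = reg t i + d" "reg s i \<le> reg t i" "frame (For i q c) s t" "I (reg t i) t" for d t
    using that
  proof (induction d arbitrary: t)
    case 0
    then have "reg t q = reg s q" using regs by (simp add: frame_def)
    with 0 show ?case by (intro run_While_exit) simp_all
  next
    case (Suc d)
    have q: "reg t q = reg s q" using Suc.prems regs by (simp add: frame_def)
    have "run c t (\<lambda>n t'. n \<le> B \<and> I (Suc (reg t i)) (set_reg i (Suc (reg t i)) t'))"
      using Suc.prems by (intro step) simp_all
    then have "run c t (\<lambda>m t'. run (For i q c) (set_reg i (Suc (reg t' i)) t')
        (\<lambda>n t'. 1 + (m + 1) + n \<le> 1 + Suc d * (B + 2) \<and> I (reg s q) t'))"
    proof (rule run_conseq)
      fix m t'
      assume Q: "m \<le> B \<and> I (Suc (reg t i)) (set_reg i (Suc (reg t i)) t')" and f: "frame c t t'"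
      have i: "reg t' i = reg t i" using f regs by (simp add: frame_def)
      have "frame (For i q c) s (set_reg i (Suc (reg t' i)) t')"
        using Suc.prems(3) f by (auto simp: frame_def)
      then have "run (For i q c) (set_reg i (Suc (reg t' i)) t')
          (\<lambda>n t'. n \<le> 1 + d * (B + 2) \<and> I (reg s q) t')"
        using Q i Suc.prems by (intro Suc.IH) simp_all
      then show "run (For i q c) (set_reg i (Suc (reg t' i)) t')
          (\<lambda>n t'. 1 + (m + 1) + n \<le> 1 + Suc d * (B + 2) \<and> I (reg s q) t')"
        by (rule run_conseq) (use Q in auto)
    qed
    then show ?case
      using q Suc.prems(1) by (intro run_While_step) simp_all
  qed
  from this[of s "reg s q - reg s i"] show ?thesis
    using le init by (simp add: frame_def)
qed

section \<open>The program\<close>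

text \<open>
  Registers 10 to 14 are scratch space of the two subroutines, and register 22 stays 0. A vertex
  \<open>x\<close> counts as marked in round \<open>k\<close> if \<open>M[x] > k\<close>; marking writes \<open>k + 1\<close>, so that the marks
  of earlier rounds need not be erased.

  In round \<open>j\<close> of \<open>family_edges\<close>, array 15 marks the vertices of \<open>H j\<close> and array 16 those at
  distance at most 1 from them. In round \<open>t\<close> of \<open>family_bags\<close>, array 17 marks the bag \<open>X t\<close>, and
  register 24 counts the entries written to array 14.
\<close>

definition mark_segment :: "nat \<Rightarrow> nat \<Rightarrow> nat \<Rightarrow> nat \<Rightarrow> nat \<Rightarrow> com" where
  "mark_segment off a i M v =
     Seq (Load 10 off i) (Seq (Copy 11 i) (Seq (Inc 11) (Seq (Load 11 off 11)
       (For 10 11 (Seq (Load 12 a 10) (Store M 12 v))))))"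

definition hit_segment :: "nat \<Rightarrow> nat \<Rightarrow> nat \<Rightarrow> nat \<Rightarrow> nat \<Rightarrow> com" where
  "hit_segment off a i M th =
     Seq (Const 14 0) (Seq (Load 10 off i) (Seq (Copy 11 i) (Seq (Inc 11) (Seq (Load 11 off 11)
       (For 10 11 (Seq (Load 12 a 10) (Seq (Load 13 M 12)
         (IfLess th 13 (Const 14 1) Skip))))))))"

section \<open>Marking and testing a single stored set\<close>

lemma written_mark_segment [simp]:
  "written_regs (mark_segment off a i M v) = {10, 11, 12}"
  "written_arrs (mark_segment off a i M v) = {M}"
  by (auto simp: mark_segment_def)

lemma written_hit_segment [simp]:
  "written_regs (hit_segment off a i M th) = {10, 11, 12, 13, 14}"
  "written_arrs (hit_segment off a i M th) = {}"
  by (auto simp: hit_segment_def)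

text \<open>Stored lists have no repetitions, so \<open>N\<close> bounds the length of the segment.
  The 5 is made up of four instructions before the loop and its last test. Marks must not overwrite
  the arrays that are being read, hence the conditions on \<open>M\<close>.\<close>

lemma run_mark_segment:
  assumes "sets_at s k off a F" "reg s i < k" "card (F (reg s i)) \<le> N"
    and "i \<notin> {10, 11, 12}" "v \<notin> {10, 11, 12}" "M \<noteq> a" "M \<noteq> off"
  shows "run (mark_segment off a i M v) s (\<lambda>n s'. n \<le> 5 + 4 * N \<and>
    arr s' M = (\<lambda>x. if x \<in> F (reg s i) then reg s v else arr s M x))"
proof -
  define lo hi where "lo = arr s off (reg s i)" and "hi = arr s off (Suc (reg s i))"
  have le: "lo \<le> hi" and F: "bij_betw (arr s a) {lo..<hi} (F (reg s i))"
    using assms by (auto simp: sets_at_def offsets_at_def segment_def lo_def hi_def)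
  have len: "hi - lo \<le> N"
    using bij_betw_same_card[OF F] assms(3) by simp
  have img: "arr s a ` {lo..<hi} = F (reg s i)"
    using F by (simp add: bij_betw_def)
  \<comment> \<open>Register 11 first holds the address of the next offset entry, and then that
    entry itself.\<close>
  define s1 where "s1 = set_reg 11 hi (set_reg 11 (Suc (reg s i))
    (set_reg 11 (reg s i) (set_reg 10 lo s)))"
  have "run (For 10 11 (Seq (Load 12 a 10) (Store M 12 v))) s1 (\<lambda>n t. n \<le> 1 + (reg s1 11 - reg s1 10) * (2 + 2) \<and>
    arr t M = (\<lambda>x. if x \<in> arr s a ` {lo..<reg s1 11} then reg s v else arr s M x))"
    by (rule run_For[where I = "\<lambda>k t. arr t M = (\<lambda>x. if x \<in> arr s a ` {lo..<k} then reg s v else arr s M x)"])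
      (use assms le in \<open>auto simp: s1_def frame_def atLeastLessThanSuc fun_eq_iff\<close>)
  then have "run (For 10 11 (Seq (Load 12 a 10) (Store M 12 v))) s1 (\<lambda>n t. 4 + n \<le> 5 + 4 * N \<and>
    arr t M = (\<lambda>x. if x \<in> F (reg s i) then reg s v else arr s M x))"
    by (rule run_conseq) (use len img in \<open>simp add: s1_def\<close>)
  then show ?thesis
    using assms by (simp add: mark_segment_def lo_def hi_def s1_def)
qed

text \<open>Register 14 acts as a truth value: cleared at the start, set at every hit, and not reset
  during the scan. The body takes 4 steps: two loads, a test and its branch.\<close>

lemma run_hit_segment:
  assumes "sets_at s k off a F" "reg s i < k" "card (F (reg s i)) \<le> N"
    and "i \<notin> {10, 11, 12, 13, 14}" "th \<notin> {10, 11, 12, 13, 14}"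
  shows "run (hit_segment off a i M th) s (\<lambda>n s'. n \<le> 6 + 6 * N \<and>
    (0 < reg s' 14 \<longleftrightarrow> (\<exists>x\<in>F (reg s i). reg s th < arr s M x)))"
proof -
  define lo hi where "lo = arr s off (reg s i)" and "hi = arr s off (Suc (reg s i))"
  have le: "lo \<le> hi" and F: "bij_betw (arr s a) {lo..<hi} (F (reg s i))"
    using assms by (auto simp: sets_at_def offsets_at_def segment_def lo_def hi_def)
  have len: "hi - lo \<le> N"
    using bij_betw_same_card[OF F] assms(3) by simp
  have img: "F (reg s i) = arr s a ` {lo..<hi}"
    using F by (simp add: bij_betw_def)
  define s1 where "s1 = set_reg 11 hi (set_reg 11 (Suc (reg s i))
    (set_reg 11 (reg s i) (set_reg 10 lo (set_reg 14 0 s))))"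
  let ?c = "Seq (Load 12 a 10) (Seq (Load 13 M 12) (IfLess th 13 (Const 14 1) Skip))"
  have "run (For 10 11 ?c) s1 (\<lambda>n t. n \<le> 1 + (reg s1 11 - reg s1 10) * (4 + 2) \<and>
    (0 < reg t 14 \<longleftrightarrow> (\<exists>p\<in>{lo..<reg s1 11}. reg s th < arr s M (arr s a p))))"
    by (rule run_For[where I = "\<lambda>k t. 0 < reg t 14 \<longleftrightarrow> (\<exists>p\<in>{lo..<k}. reg s th < arr s M (arr s a p))"])
      (use assms le in \<open>auto simp: s1_def frame_def atLeastLessThanSuc\<close>)
  then have "run (For 10 11 ?c) s1 (\<lambda>n t. 5 + n \<le> 6 + 6 * N \<and>
    (0 < reg t 14 \<longleftrightarrow> (\<exists>x\<in>F (reg s i). reg s th < arr s M x)))"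
    by (rule run_conseq) (use len img in \<open>simp add: s1_def\<close>)
  then show ?thesis
    using assms by (simp add: hit_segment_def lo_def hi_def s1_def)
qed

section \<open>Appending to stored lists, and the phases of the program\<close>

lemma sets_at_cong:
  "arr t off = arr s off \<Longrightarrow> arr t a = arr s a \<Longrightarrow> sets_at t k off a F = sets_at s k off a F"
  by (simp add: sets_at_def offsets_at_def segment_def)

text \<open>The effect of appending \<open>x\<close> to a list without repetitions: \<open>f\<close>
  and \<open>g\<close> are the array before and after the write to cell \<open>n\<close>.\<close>

lemma bij_betw_atLeastLessThan_Suc:
  assumes "bij_betw f {m..<n} S" "x \<notin> S" "m \<le> n" "\<And>i. m \<le> i \<Longrightarrow> i < n \<Longrightarrow> g i = f i" "g n = x"
  shows "bij_betw g {m..<Suc n} (insert x S)"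
proof -
  have "bij_betw g {m..<n} S"
    using assms(1,4) bij_betw_cong[of "{m..<n}" g f S] by simp
  then have "bij_betw g ({m..<n} \<union> {n}) (S \<union> {x})"
    by (rule notIn_Un_bij_betw[rotated 2, of g _ S n, unfolded assms(5)]) (use assms in auto)
  then show ?thesis
    using assms(3) by (simp add: atLeastLessThanSuc)
qed

text \<open>Marks are read from array 15 but written to array 16, so that they cannot spread beyond
  distance 1. Each edge is tried in both directions.\<close>

definition close_marks :: com where
  "close_marks = Seq (Const 18 0) (For 18 1
     (Seq (Load 19 0 18) (Seq (Load 20 1 18)
       (Seq (Load 21 15 19) (Seq (IfLess 7 21 (Store 16 20 17) Skip)
         (Seq (Load 21 15 20) (IfLess 7 21 (Store 16 19 17) Skip)))))))"

text \<open>The scan stops before the current index in register 7, so each edge is listed only once,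
  at its larger end. Register 6 is both the number of edges and the next free cell.\<close>

definition adjacency_row :: com where
  "adjacency_row = Seq (Const 8 0) (For 8 7
     (Seq (hit_segment 2 3 8 16 7)
       (IfLess 22 14 (Seq (Store 11 6 8) (Seq (Store 12 6 7) (Inc 6))) Skip)))"

definition family_edges :: com where
  "family_edges = For 7 2
     (Seq (Copy 17 7) (Seq (Inc 17) (Seq (mark_segment 2 3 7 15 17) (Seq (mark_segment 2 3 7 16 17)
       (Seq close_marks adjacency_row)))))"

text \<open>Register 24 is not reset between rows, because the bags are concatenated in array
  14.\<close>

definition bag_row :: com where
  "bag_row = Seq (Const 7 0) (For 7 2
     (Seq (hit_segment 2 3 7 17 23) (IfLess 22 14 (Seq (Store 14 24 7) (Inc 24)) Skip)))"

text \<open>In round \<open>t\<close> register 17 holds \<open>t + 1\<close>, at once the mark of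
  this round and the address of the offset at which bag \<open>t\<close> ends. Offset 0 is the
  initial 0 of array 13.\<close>

definition family_bags :: com where
  "family_bags = For 23 3
     (Seq (Copy 17 23) (Seq (Inc 17) (Seq (mark_segment 9 10 23 17 17)
       (Seq bag_row (Store 13 17 24)))))"

lemma written_close_marks [simp]:
  "written_regs close_marks = {18, 19, 20, 21}" "written_arrs close_marks = {16}"
  by (auto simp: close_marks_def)

lemma written_adjacency_row [simp]:
  "written_regs adjacency_row = {6, 8, 10, 11, 12, 13, 14}" "written_arrs adjacency_row = {11, 12}"
  by (auto simp: adjacency_row_def)

lemma written_family_edges [simp]:
  "written_regs family_edges = {6, 7, 8, 10, 11, 12, 13, 14, 17, 18, 19, 20, 21}"
  "written_arrs family_edges = {11, 12, 15, 16}"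
  by (auto simp: family_edges_def)

lemma written_bag_row [simp]:
  "written_regs bag_row = {7, 10, 11, 12, 13, 14, 24}" "written_arrs bag_row = {14}"
  by (auto simp: bag_row_def)

lemma written_family_bags [simp]:
  "written_regs family_bags = {7, 10, 11, 12, 13, 14, 17, 23, 24}"
  "written_arrs family_bags = {13, 14, 17}"
  by (auto simp: family_bags_def)

text \<open>The upper bound on array 16 makes all marks of this round stale in the next one. An edge
  costs 8 steps of the body and 2 of the loop.\<close>

lemma run_close_marks:
  assumes "reg s 17 = Suc (reg s 7)"
    and "\<And>x. reg s 7 < arr s 15 x \<longleftrightarrow> x \<in> S"
    and "\<And>x. reg s 7 < arr s 16 x \<longleftrightarrow> x \<in> S"
    and "\<And>x. arr s 16 x \<le> reg s 17"
  shows "run close_marks s (\<lambda>n s'. n \<le> 2 + reg s 1 * 10 \<and>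
    (\<forall>x. arr s' 16 x \<le> reg s 17) \<and>
    (\<forall>x. reg s 7 < arr s' 16 x \<longleftrightarrow> x \<in> S \<or>
       (\<exists>e<reg s 1. arr s 0 e \<in> S \<and> arr s 1 e = x \<or> arr s 1 e \<in> S \<and> arr s 0 e = x)))"
proof -
  let ?c = "Seq (Load 19 0 18) (Seq (Load 20 1 18)
       (Seq (Load 21 15 19) (Seq (IfLess 7 21 (Store 16 20 17) Skip)
         (Seq (Load 21 15 20) (IfLess 7 21 (Store 16 19 17) Skip)))))"
  define I :: "nat \<Rightarrow> state \<Rightarrow> bool" where "I = (\<lambda>k t. (\<forall>x. arr t 16 x \<le> reg s 17) \<and>
    (\<forall>x. reg s 7 < arr t 16 x \<longleftrightarrow> x \<in> S \<or>
       (\<exists>e<k. arr s 0 e \<in> S \<and> arr s 1 e = x \<or> arr s 1 e \<in> S \<and> arr s 0 e = x)))"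
  define s1 where "s1 = set_reg 18 0 s"
  have "run (For 18 1 ?c) s1 (\<lambda>n t. n \<le> 1 + (reg s1 1 - reg s1 18) * (8 + 2) \<and> I (reg s1 1) t)"
    by (rule run_For[where I = I])
      (use assms in \<open>auto simp: s1_def I_def frame_def less_Suc_eq\<close>)
  then have "run (For 18 1 ?c) s1 (\<lambda>n t. 1 + n \<le> 2 + reg s 1 * 10 \<and> I (reg s 1) t)"
    by (rule run_conseq) (simp add: s1_def)
  then show ?thesis
    by (simp add: close_marks_def s1_def I_def)
qed

text \<open>\<open>C\<close> stands for the closed neighbourhood of the current subgraph and
  \<open>E\<close> for the edges of earlier rounds. As no member of \<open>E\<close> contains the
  current index, every pair written is new.\<close>

lemma run_adjacency_row:
  assumes V: "sets_at s k 2 3 V" "reg s 7 \<le> k" "\<And>i. i < k \<Longrightarrow> card (V i) \<le> N"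
    and zero: "reg s 22 = 0"
    and C: "\<And>x. reg s 7 < arr s 16 x \<longleftrightarrow> x \<in> C"
    and E: "bij_betw (\<lambda>e. {arr s 11 e, arr s 12 e}) {..<reg s 6} E" "\<And>e. e \<in> E \<Longrightarrow> reg s 7 \<notin> e"
  shows "run adjacency_row s (\<lambda>n s'. n \<le> 2 + reg s 7 * (12 + 6 * N) \<and>
    bij_betw (\<lambda>e. {arr s' 11 e, arr s' 12 e}) {..<reg s' 6}
      (E \<union> {{i, reg s 7} | i. i < reg s 7 \<and> V i \<inter> C \<noteq> {}}))"
proof -
  let ?d = "IfLess 22 14 (Seq (Store 11 6 8) (Seq (Store 12 6 7) (Inc 6))) Skip"
  let ?c = "Seq (hit_segment 2 3 8 16 7) ?d"
  define I :: "nat \<Rightarrow> state \<Rightarrow> bool" where "I = (\<lambda>l t. bij_betw (\<lambda>e. {arr t 11 e, arr t 12 e}) {..<reg t 6}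
      (E \<union> {{i, reg s 7} | i. i < l \<and> V i \<inter> C \<noteq> {}}))"
  define s1 where "s1 = set_reg 8 0 s"
  have "run (For 8 7 ?c) s1
    (\<lambda>n t. n \<le> 1 + (reg s1 7 - reg s1 8) * ((10 + 6 * N) + 2) \<and> I (reg s1 7) t)"
  proof (rule run_For[where I = I])
    fix l t
    assume l: "l < reg s1 7" and tl: "reg t 8 = l" and fr: "frame (For 8 7 ?c) s1 t" and It: "I l t"
    have l: "l < reg s 7" using l by (simp add: s1_def)
    have fr: "reg t 7 = reg s 7" "reg t 22 = 0" "\<And>a. a \<noteq> 11 \<Longrightarrow> a \<noteq> 12 \<Longrightarrow> arr t a = arr s a"
      using fr zero by (auto simp: frame_def s1_def)
    have "run (hit_segment 2 3 8 16 7) t (\<lambda>n t'. n \<le> 6 + 6 * N \<and>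
        (0 < reg t' 14 \<longleftrightarrow> (\<exists>x\<in>V (reg t 8). reg t 7 < arr t 16 x)))"
      using V fr tl l by (intro run_hit_segment[where k = k]) (simp_all add: sets_at_cong[of t _ s])
    then have "run (hit_segment 2 3 8 16 7) t (\<lambda>m t'. run ?d t'
      (\<lambda>n t'. m + n \<le> 10 + 6 * N \<and> I (Suc l) (set_reg 8 (Suc l) t')))"
    proof (rule run_conseq)
      fix n t'
      assume Q: "n \<le> 6 + 6 * N \<and> (0 < reg t' 14 \<longleftrightarrow> (\<exists>x\<in>V (reg t 8). reg t 7 < arr t 16 x))"
        and f: "frame (hit_segment 2 3 8 16 7) t t'"
      have f: "reg t' 8 = l" "reg t' 7 = reg s 7" "reg t' 22 = 0" "reg t' 6 = reg t 6" "arr t' = arr t"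
        using f fr tl by (auto simp: frame_def)
      have hit: "0 < reg t' 14 \<longleftrightarrow> V l \<inter> C \<noteq> {}"
        using Q C tl fr by auto
      let ?E = "\<lambda>l. E \<union> {{i, reg s 7} | i. i < l \<and> V i \<inter> C \<noteq> {}}"
      show "run ?d t' (\<lambda>m t'. n + m \<le> 10 + 6 * N \<and> I (Suc l) (set_reg 8 (Suc l) t'))"
      proof (cases "V l \<inter> C = {}")
        case True
        then have "?E (Suc l) = ?E l" by (auto simp: less_Suc_eq)
        with True show ?thesis using Q f hit It by (simp add: I_def)
      next
        case False
        then have "?E (Suc l) = insert {l, reg s 7} (?E l)" by (auto simp: less_Suc_eq)
        \<comment> \<open>The index \<open>l\<close> differs from all \<open>i < l\<close> and from
          the current index, so this pair has not been written in this round either.\<close>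
        moreover have "{l, reg s 7} \<notin> ?E l"
          using E(2) l by (auto simp: doubleton_eq_iff)
        ultimately have "bij_betw (\<lambda>e. {((arr t 11)(reg t 6 := l)) e, ((arr t 12)(reg t 6 := reg s 7)) e})
            {..<Suc (reg t 6)} (?E (Suc l))"
          using It unfolding I_def lessThan_atLeast0
          by (simp only:) (rule bij_betw_atLeastLessThan_Suc, auto)
        with False show ?thesis using Q f hit by (simp add: I_def cong: if_cong)
      qed
    qed
    then show "run ?c t (\<lambda>n t'. n \<le> 10 + 6 * N \<and> I (Suc l) (set_reg 8 (Suc l) t'))"
      by simp
  qed (use E in \<open>auto simp: s1_def I_def\<close>)
  then have "run (For 8 7 ?c) s1 (\<lambda>n t. 1 + n \<le> 2 + reg s 7 * (12 + 6 * N) \<and> I (reg s 7) t)"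
    by (rule run_conseq) (simp add: s1_def)
  then show ?thesis
    by (simp add: adjacency_row_def s1_def I_def)
qed

text \<open>Cells below the initial value of register 24 hold the earlier bags and must survive. The
  new entries are distinct since the indices are scanned in increasing order.\<close>

lemma run_bag_row:
  assumes V: "sets_at s (reg s 2) 2 3 V" "\<And>i. i < reg s 2 \<Longrightarrow> card (V i) \<le> N"
    and zero: "reg s 22 = 0"
    and Y: "\<And>x. reg s 23 < arr s 17 x \<longleftrightarrow> x \<in> Y"
  shows "run bag_row s (\<lambda>n s'. n \<le> 2 + reg s 2 * (11 + 6 * N) \<and>
    reg s 24 \<le> reg s' 24 \<and> (\<forall>p<reg s 24. arr s' 14 p = arr s 14 p) \<and>
    bij_betw (arr s' 14) {reg s 24..<reg s' 24} {j. j < reg s 2 \<and> V j \<inter> Y \<noteq> {}})"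
proof -
  let ?d = "IfLess 22 14 (Seq (Store 14 24 7) (Inc 24)) Skip"
  let ?c = "Seq (hit_segment 2 3 7 17 23) ?d"
  define I :: "nat \<Rightarrow> state \<Rightarrow> bool" where "I = (\<lambda>l t. reg s 24 \<le> reg t 24 \<and> (\<forall>p<reg s 24. arr t 14 p = arr s 14 p) \<and>
    bij_betw (arr t 14) {reg s 24..<reg t 24} {j. j < l \<and> V j \<inter> Y \<noteq> {}})"
  define s1 where "s1 = set_reg 7 0 s"
  have "run (For 7 2 ?c) s1
    (\<lambda>n t. n \<le> 1 + (reg s1 2 - reg s1 7) * ((9 + 6 * N) + 2) \<and> I (reg s1 2) t)"
  proof (rule run_For[where I = I])
    fix l t
    assume l: "l < reg s1 2" and tl: "reg t 7 = l" and fr: "frame (For 7 2 ?c) s1 t" and It: "I l t"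
    have l: "l < reg s 2" using l by (simp add: s1_def)
    have fr: "reg t 23 = reg s 23" "reg t 22 = 0" "\<And>a. a \<noteq> 14 \<Longrightarrow> arr t a = arr s a"
      using fr zero by (auto simp: frame_def s1_def)
    have "run (hit_segment 2 3 7 17 23) t (\<lambda>n t'. n \<le> 6 + 6 * N \<and>
        (0 < reg t' 14 \<longleftrightarrow> (\<exists>x\<in>V (reg t 7). reg t 23 < arr t 17 x)))"
      using V fr tl l by (intro run_hit_segment[where k = "reg s 2"]) (simp_all add: sets_at_cong[of t _ s])
    then have "run (hit_segment 2 3 7 17 23) t (\<lambda>m t'. run ?d t'
      (\<lambda>n t'. m + n \<le> 9 + 6 * N \<and> I (Suc l) (set_reg 7 (Suc l) t')))"
    proof (rule run_conseq)
      fix n t'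
      assume Q: "n \<le> 6 + 6 * N \<and> (0 < reg t' 14 \<longleftrightarrow> (\<exists>x\<in>V (reg t 7). reg t 23 < arr t 17 x))"
        and f: "frame (hit_segment 2 3 7 17 23) t t'"
      have f: "reg t' 7 = l" "reg t' 22 = 0" "reg t' 24 = reg t 24" "arr t' = arr t"
        using f fr tl by (auto simp: frame_def)
      have hit: "0 < reg t' 14 \<longleftrightarrow> V l \<inter> Y \<noteq> {}"
        using Q Y tl fr by auto
      let ?F = "\<lambda>l. {j. j < l \<and> V j \<inter> Y \<noteq> {}}"
      show "run ?d t' (\<lambda>m t'. n + m \<le> 9 + 6 * N \<and> I (Suc l) (set_reg 7 (Suc l) t'))"
      proof (cases "V l \<inter> Y = {}")
        case True
        then have "?F (Suc l) = ?F l" by (auto simp: less_Suc_eq)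
        with True show ?thesis using Q f hit It by (simp add: I_def)
      next
        case False
        then have "?F (Suc l) = insert l (?F l)" by (auto simp: less_Suc_eq)
        then have "bij_betw ((arr t 14)(reg t 24 := l)) {reg s 24..<Suc (reg t 24)} (?F (Suc l))"
          using It unfolding I_def
          by (simp only:) (rule bij_betw_atLeastLessThan_Suc, auto)
        with False show ?thesis using Q f hit It by (simp add: I_def)
      qed
    qed
    then show "run ?c t (\<lambda>n t'. n \<le> 9 + 6 * N \<and> I (Suc l) (set_reg 7 (Suc l) t'))"
      by simp
  qed (auto simp: s1_def I_def bij_betw_def)
  then have "run (For 7 2 ?c) s1 (\<lambda>n t. 1 + n \<le> 2 + reg s 2 * (11 + 6 * N) \<and> I (reg s 2) t)"
    by (rule run_conseq) (simp add: s1_def)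
  then show ?thesis
    by (simp add: bag_row_def s1_def I_def)
qed

text \<open>\<open>C j\<close> is the closed neighbourhood of \<open>V j\<close>, read off from the
  edge list; the pairs are collected by their larger element.\<close>

lemma run_family_edges:
  fixes s :: state and V :: "nat \<Rightarrow> nat set"
  defines "C \<equiv> \<lambda>j. {x. x \<in> V j \<or>
    (\<exists>e<reg s 1. arr s 0 e \<in> V j \<and> arr s 1 e = x \<or> arr s 1 e \<in> V j \<and> arr s 0 e = x)}"
  assumes V: "sets_at s (reg s 2) 2 3 V" "\<And>i. i < reg s 2 \<Longrightarrow> card (V i) \<le> N"
    and regs: "reg s 6 = 0" "reg s 7 = 0" "reg s 22 = 0"
    and arrs: "\<And>x. arr s 15 x = 0" "\<And>x. arr s 16 x = 0"
  shows "run family_edges s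
    (\<lambda>n s'. n \<le> 1 + reg s 2 * (18 + 8 * N + reg s 1 * 10 + reg s 2 * (12 + 6 * N)) \<and>
      bij_betw (\<lambda>e. {arr s' 11 e, arr s' 12 e}) {..<reg s' 6}
        {{i, j} | i j. i < j \<and> j < reg s 2 \<and> V i \<inter> C j \<noteq> {}})"
proof -
  let ?E = "\<lambda>k. {{i, j} | i j. i < j \<and> j < k \<and> V i \<inter> C j \<noteq> {}}"
  let ?c = "Seq (Copy 17 7) (Seq (Inc 17) (Seq (mark_segment 2 3 7 15 17) (Seq (mark_segment 2 3 7 16 17)
       (Seq close_marks adjacency_row))))"
  \<comment> \<open>Two assignments, two markings, one pass over the edges, and a row, generously
    charged with a scan of all sets.\<close>
  let ?B = "16 + 8 * N + reg s 1 * 10 + reg s 2 * (12 + 6 * N)"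
  \<comment> \<open>With all marks at most \<open>k\<close> when round \<open>k\<close> starts, no
    vertex counts as marked at that moment.\<close>
  define I :: "nat \<Rightarrow> state \<Rightarrow> bool" where "I = (\<lambda>k t. (\<forall>x. arr t 15 x \<le> k) \<and> (\<forall>x. arr t 16 x \<le> k) \<and>
    bij_betw (\<lambda>e. {arr t 11 e, arr t 12 e}) {..<reg t 6} (?E k))"
  have "run (For 7 2 ?c) s (\<lambda>n t. n \<le> 1 + (reg s 2 - reg s 7) * (?B + 2) \<and> I (reg s 2) t)"
  proof (rule run_For[where I = I])
    fix k t
    assume k: "k < reg s 2" and tk: "reg t 7 = k" and fr: "frame (For 7 2 ?c) s t" and It: "I k t"
    have fr: "reg t 1 = reg s 1" "reg t 22 = 0" "\<And>a. a < 11 \<Longrightarrow> arr t a = arr s a"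
      using fr regs by (auto simp: frame_def)
    define t1 where "t1 = set_reg 17 (Suc k) (set_reg 17 k t)"
    have t1: "arr t1 = arr t" by (simp add: t1_def)
    have "run (mark_segment 2 3 7 15 17) t1 (\<lambda>n s'. n \<le> 5 + 4 * N \<and>
        arr s' 15 = (\<lambda>x. if x \<in> V (reg t1 7) then reg t1 17 else arr t1 15 x))"
      using V k tk fr t1 by (intro run_mark_segment[where k = "reg s 2"])
        (simp_all add: sets_at_cong[of t1 _ s], simp_all add: t1_def)
    then have "run (mark_segment 2 3 7 15 17) t1 (\<lambda>m2 t2. run (mark_segment 2 3 7 16 17) t2
      (\<lambda>m3 t3. run close_marks t3 (\<lambda>m4 t4. run adjacency_row t4
      (\<lambda>m5 t5. 2 + m2 + m3 + m4 + m5 \<le> ?B \<and> I (Suc k) (set_reg 7 (Suc k) t5)))))"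
    proof (rule run_conseq)
      fix m2 t2
      assume Q2: "m2 \<le> 5 + 4 * N \<and>
        arr t2 15 = (\<lambda>x. if x \<in> V (reg t1 7) then reg t1 17 else arr t1 15 x)"
        and "frame (mark_segment 2 3 7 15 17) t1 t2"
      then have f2: "reg t2 1 = reg s 1" "reg t2 7 = k" "reg t2 17 = Suc k" "reg t2 22 = 0"
        "reg t2 6 = reg t 6"
        "\<And>a. a < 11 \<Longrightarrow> arr t2 a = arr s a" "\<And>a. a \<noteq> 15 \<Longrightarrow> arr t2 a = arr t a"
        using fr tk by (auto simp: frame_def t1_def)
      have "run (mark_segment 2 3 7 16 17) t2 (\<lambda>n s'. n \<le> 5 + 4 * N \<and>
          arr s' 16 = (\<lambda>x. if x \<in> V (reg t2 7) then reg t2 17 else arr t2 16 x))"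
        using V k f2 by (intro run_mark_segment[where k = "reg s 2"])
          (simp_all add: sets_at_cong[of t2 _ s])
      then show "run (mark_segment 2 3 7 16 17) t2
        (\<lambda>m3 t3. run close_marks t3 (\<lambda>m4 t4. run adjacency_row t4
        (\<lambda>m5 t5. 2 + m2 + m3 + m4 + m5 \<le> ?B \<and> I (Suc k) (set_reg 7 (Suc k) t5))))"
      proof (rule run_conseq)
        fix m3 t3
        assume Q3: "m3 \<le> 5 + 4 * N \<and>
          arr t3 16 = (\<lambda>x. if x \<in> V (reg t2 7) then reg t2 17 else arr t2 16 x)"
          and fm: "frame (mark_segment 2 3 7 16 17) t2 t3"
        then have f3: "reg t3 1 = reg s 1" "reg t3 7 = k" "reg t3 17 = Suc k" "reg t3 22 = 0"
          "reg t3 6 = reg t 6"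
          "\<And>a. a < 11 \<Longrightarrow> arr t3 a = arr s a" "\<And>a. a \<noteq> 15 \<Longrightarrow> a \<noteq> 16 \<Longrightarrow> arr t3 a = arr t a"
          using f2 by (auto simp: frame_def)
        have a15: "arr t3 15 = (\<lambda>x. if x \<in> V k then Suc k else arr t 15 x)"
          using fm Q2 tk by (simp add: frame_def t1_def cong: if_cong)
        have a16: "arr t3 16 = (\<lambda>x. if x \<in> V k then Suc k else arr t 16 x)"
          using Q3 f2 by (simp cong: if_cong)
        have le: "\<not> k < arr t 15 x" "\<not> k < arr t 16 x" "arr t 16 x \<le> Suc k" "arr t 15 x \<le> Suc k" for x
          using It by (auto simp: I_def not_less intro: le_SucI)
        have "run close_marks t3 (\<lambda>n s'. n \<le> 2 + reg t3 1 * 10 \<and>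
          (\<forall>x. arr s' 16 x \<le> reg t3 17) \<and>
          (\<forall>x. reg t3 7 < arr s' 16 x \<longleftrightarrow> x \<in> V k \<or>
             (\<exists>e<reg t3 1. arr t3 0 e \<in> V k \<and> arr t3 1 e = x \<or> arr t3 1 e \<in> V k \<and> arr t3 0 e = x)))"
          by (rule run_close_marks) (use f3 a15 a16 le in auto)
        then show "run close_marks t3 (\<lambda>m4 t4. run adjacency_row t4
          (\<lambda>m5 t5. 2 + m2 + m3 + m4 + m5 \<le> ?B \<and> I (Suc k) (set_reg 7 (Suc k) t5)))"
        proof (rule run_conseq)
          fix m4 t4
          assume Q4: "m4 \<le> 2 + reg t3 1 * 10 \<and> (\<forall>x. arr t4 16 x \<le> reg t3 17) \<and>
            (\<forall>x. reg t3 7 < arr t4 16 x \<longleftrightarrow> x \<in> V k \<or>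
             (\<exists>e<reg t3 1. arr t3 0 e \<in> V k \<and> arr t3 1 e = x \<or> arr t3 1 e \<in> V k \<and> arr t3 0 e = x))"
            and fc: "frame close_marks t3 t4"
          have f4: "reg t4 7 = k" "reg t4 22 = 0" "reg t4 6 = reg t 6"
            "\<And>a. a < 11 \<Longrightarrow> arr t4 a = arr s a" "\<And>a. a \<noteq> 15 \<Longrightarrow> a \<noteq> 16 \<Longrightarrow> arr t4 a = arr t a"
            "arr t4 15 = arr t3 15"
            using fc f3 by (auto simp: frame_def)
          have C: "k < arr t4 16 x \<longleftrightarrow> x \<in> C k" for x
            using Q4 f3 by (simp add: C_def)
          \<comment> \<open>Both elements of a pair in \<open>?E k\<close> lie below
            \<open>k\<close>, which gives the required freshness of the index
            \<open>k\<close>.\<close>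
          have "run adjacency_row t4 (\<lambda>n s'. n \<le> 2 + reg t4 7 * (12 + 6 * N) \<and>
            bij_betw (\<lambda>e. {arr s' 11 e, arr s' 12 e}) {..<reg s' 6}
              (?E k \<union> {{i, reg t4 7} | i. i < reg t4 7 \<and> V i \<inter> C k \<noteq> {}}))"
            by (rule run_adjacency_row[where k = "reg s 2"])
              (use V k f4 C It in \<open>auto simp: sets_at_cong[of t4 _ s] I_def\<close>)
          then show "run adjacency_row t4
            (\<lambda>m5 t5. 2 + m2 + m3 + m4 + m5 \<le> ?B \<and> I (Suc k) (set_reg 7 (Suc k) t5))"
          proof (rule run_conseq)
            fix m5 t5
            assume Q5: "m5 \<le> 2 + reg t4 7 * (12 + 6 * N) \<and>
              bij_betw (\<lambda>e. {arr t5 11 e, arr t5 12 e}) {..<reg t5 6}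
              (?E k \<union> {{i, reg t4 7} | i. i < reg t4 7 \<and> V i \<inter> C k \<noteq> {}})"
              and fa: "frame adjacency_row t4 t5"
            have "k * (12 + 6 * N) \<le> reg s 2 * (12 + 6 * N)"
              using k by (intro mult_le_mono1) simp
            moreover have "m4 \<le> 2 + reg s 1 * 10" "m5 \<le> 2 + k * (12 + 6 * N)"
              using Q4 Q5 f3(1) f4(1) by simp_all
            ultimately have "2 + m2 + m3 + m4 + m5 \<le> ?B"
              using Q2 Q3 by linarith
            moreover have "?E (Suc k) = ?E k \<union> {{i, reg t4 7} | i. i < reg t4 7 \<and> V i \<inter> C k \<noteq> {}}"
              unfolding f4(1) less_Suc_eq by blast
            moreover have "arr t5 15 = arr t3 15" "arr t5 16 = arr t4 16"
              using fa f4 by (auto simp: frame_def)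
            moreover have "arr t3 15 x \<le> Suc k" for x
              using a15 le by simp
            ultimately show "2 + m2 + m3 + m4 + m5 \<le> ?B \<and> I (Suc k) (set_reg 7 (Suc k) t5)"
              using Q4 Q5 f3 by (simp add: I_def)
          qed
        qed
      qed
    qed
    then show "run ?c t (\<lambda>n t'. n \<le> ?B \<and> I (Suc k) (set_reg 7 (Suc k) t'))"
      by (simp add: t1_def tk add.assoc)
  qed (use regs arrs in \<open>auto simp: I_def bij_betw_def\<close>)
  then show ?thesis
    unfolding family_edges_def by (rule run_conseq) (use regs in \<open>simp add: I_def add.assoc\<close>)
qed

text \<open>Each node pays for marking its bag and for scanning every set against it. Zero in
  register 24 and in offset 0 encodes the empty sequence of bags.\<close>

lemma run_family_bags:
  assumes V: "sets_at s (reg s 2) 2 3 V" "\<And>i. i < reg s 2 \<Longrightarrow> card (V i) \<le> N"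
    and X: "sets_at s (reg s 3) 9 10 X" "\<And>t. t < reg s 3 \<Longrightarrow> card (X t) \<le> N"
    and regs: "reg s 22 = 0" "reg s 23 = 0" "reg s 24 = 0"
    and arrs: "arr s 13 0 = 0" "\<And>x. arr s 17 x = 0"
  shows "run family_bags s
    (\<lambda>n s'. n \<le> 1 + reg s 3 * (12 + 4 * N + reg s 2 * (11 + 6 * N)) \<and>
      sets_at s' (reg s 3) 13 14 (\<lambda>t. {j. j < reg s 2 \<and> V j \<inter> X t \<noteq> {}}))"
proof -
  let ?Y = "\<lambda>t. {j. j < reg s 2 \<and> V j \<inter> X t \<noteq> {}}"
  let ?c = "Seq (Copy 17 23) (Seq (Inc 17) (Seq (mark_segment 9 10 23 17 17)
       (Seq bag_row (Store 13 17 24))))"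
  let ?B = "10 + 4 * N + reg s 2 * (11 + 6 * N)"
  \<comment> \<open>Before round \<open>k\<close>, offset \<open>k\<close> is the next free cell of
    array 14 and the first \<open>k\<close> bags are final.\<close>
  define I :: "nat \<Rightarrow> state \<Rightarrow> bool" where
    "I = (\<lambda>k t. (\<forall>x. arr t 17 x \<le> k) \<and> arr t 13 k = reg t 24 \<and> sets_at t k 13 14 ?Y)"
  have "run (For 23 3 ?c) s (\<lambda>n t. n \<le> 1 + (reg s 3 - reg s 23) * (?B + 2) \<and> I (reg s 3) t)"
  proof (rule run_For[where I = I])
    fix k t
    assume k: "k < reg s 3" and tk: "reg t 23 = k" and fr: "frame (For 23 3 ?c) s t" and It: "I k t"
    have fr: "reg t 2 = reg s 2" "reg t 22 = 0" "\<And>a. a < 11 \<Longrightarrow> arr t a = arr s a"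
      using fr regs by (auto simp: frame_def)
    define t1 where "t1 = set_reg 17 (Suc k) (set_reg 17 k t)"
    have t1: "arr t1 = arr t" by (simp add: t1_def)
    have "run (mark_segment 9 10 23 17 17) t1 (\<lambda>n s'. n \<le> 5 + 4 * N \<and>
        arr s' 17 = (\<lambda>x. if x \<in> X (reg t1 23) then reg t1 17 else arr t1 17 x))"
      using X k tk fr t1 by (intro run_mark_segment[where k = "reg s 3"])
        (simp_all add: sets_at_cong[of t1 _ s], simp_all add: t1_def)
    then have "run (mark_segment 9 10 23 17 17) t1 (\<lambda>m2 t2. run bag_row t2
      (\<lambda>m3 t3. 3 + m2 + m3 \<le> ?B \<and>
        I (Suc k) (set_reg 23 (Suc k) (set_arr 13 (reg t3 17) (reg t3 24) t3))))"
    proof (rule run_conseq)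
      fix m2 t2
      assume Q2: "m2 \<le> 5 + 4 * N \<and>
        arr t2 17 = (\<lambda>x. if x \<in> X (reg t1 23) then reg t1 17 else arr t1 17 x)"
        and "frame (mark_segment 9 10 23 17 17) t1 t2"
      then have f2: "reg t2 2 = reg s 2" "reg t2 23 = k" "reg t2 17 = Suc k" "reg t2 22 = 0"
        "reg t2 24 = reg t 24"
        "\<And>a. a < 11 \<Longrightarrow> arr t2 a = arr s a" "\<And>a. a \<noteq> 17 \<Longrightarrow> arr t2 a = arr t a"
        using fr tk by (auto simp: frame_def t1_def)
      have a17: "arr t2 17 = (\<lambda>x. if x \<in> X k then Suc k else arr t 17 x)"
        using Q2 tk by (simp add: t1_def cong: if_cong)
      have le: "\<not> k < arr t 17 x" "arr t 17 x \<le> Suc k" for x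
        using It by (auto simp: I_def not_less intro: le_SucI)
      have "run bag_row t2 (\<lambda>n s'. n \<le> 2 + reg t2 2 * (11 + 6 * N) \<and>
        reg t2 24 \<le> reg s' 24 \<and> (\<forall>p<reg t2 24. arr s' 14 p = arr t2 14 p) \<and>
        bij_betw (arr s' 14) {reg t2 24..<reg s' 24} {j. j < reg t2 2 \<and> V j \<inter> X k \<noteq> {}})"
        by (rule run_bag_row) (use V f2 a17 le in \<open>auto simp: sets_at_cong[of t2 _ s]\<close>)
      then show "run bag_row t2 (\<lambda>m3 t3. 3 + m2 + m3 \<le> ?B \<and>
        I (Suc k) (set_reg 23 (Suc k) (set_arr 13 (reg t3 17) (reg t3 24) t3)))"
      proof (rule run_conseq)
        fix m3 t3
        assume Q3: "m3 \<le> 2 + reg t2 2 * (11 + 6 * N) \<and>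
          reg t2 24 \<le> reg t3 24 \<and> (\<forall>p<reg t2 24. arr t3 14 p = arr t2 14 p) \<and>
          bij_betw (arr t3 14) {reg t2 24..<reg t3 24} {j. j < reg t2 2 \<and> V j \<inter> X k \<noteq> {}}"
          and fb: "frame bag_row t2 t3"
        have f3: "reg t3 17 = Suc k" "arr t3 17 = arr t2 17" "arr t3 13 = arr t 13"
          using fb f2 by (auto simp: frame_def)
        have off: "arr t 13 0 = 0" "\<And>i. i < k \<Longrightarrow> arr t 13 i \<le> arr t 13 (Suc i)"
          "arr t 13 k = reg t 24"
          "\<And>i. i < k \<Longrightarrow> bij_betw (arr t 14) {arr t 13 i..<arr t 13 (Suc i)} (?Y i)"
          using It by (auto simp: I_def sets_at_def offsets_at_def segment_def)
        \<comment> \<open>Earlier segments end no later than the next free cell, so the row written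
          from there on leaves them intact.\<close>
        have mono: "arr t 13 (Suc i) \<le> reg t 24" if "i < k" for i
        proof -
          have "Suc i \<le> k" using that by simp
          then have "arr t 13 (Suc i) \<le> arr t 13 k"
            by (induction rule: inc_induct) (use off(2) order_trans in blast)+
          then show ?thesis using off(3) by simp
        qed
        have old: "bij_betw (arr t3 14) {arr t 13 i..<arr t 13 (Suc i)} (?Y i)" if "i < k" for i
        proof -
          have "bij_betw (arr t3 14) {arr t 13 i..<arr t 13 (Suc i)} (?Y i) \<longleftrightarrow>
              bij_betw (arr t 14) {arr t 13 i..<arr t 13 (Suc i)} (?Y i)"
            by (rule bij_betw_cong) (use mono[OF that] Q3 f2 in simp)
          then show ?thesis using off(4)[OF that] by simp
        qed
        have new: "bij_betw (arr t3 14) {arr t 13 k..<reg t3 24} (?Y k)" "arr t 13 k \<le> reg t3 24"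
          using Q3 f2 off(3) by simp_all
        have "sets_at (set_reg 23 (Suc k) (set_arr 13 (reg t3 17) (reg t3 24) t3)) (Suc k) 13 14 ?Y"
          unfolding sets_at_def offsets_at_def segment_def
          using off(1,2) old new f3(1,3) by (simp add: less_Suc_eq all_conj_distrib)
        moreover have "arr t2 17 x \<le> Suc k" for x
          using a17 le by simp
        ultimately show "3 + m2 + m3 \<le> ?B \<and>
            I (Suc k) (set_reg 23 (Suc k) (set_arr 13 (reg t3 17) (reg t3 24) t3))"
          using Q2 Q3 f2 f3 by (simp add: I_def)
      qed
    qed
    then show "run ?c t (\<lambda>n t'. n \<le> ?B \<and> I (Suc k) (set_reg 23 (Suc k) t'))"
      by (simp add: t1_def tk add.assoc)
  qed (use regs arrs in \<open>auto simp: I_def sets_at_def offsets_at_def\<close>)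
  then show ?thesis
    unfolding family_bags_def by (rule run_conseq) (use regs in \<open>simp add: I_def add.assoc\<close>)
qed

section \<open>The tree decomposition of the graph of a family\<close>

definition family_bag :: "'j set \<Rightarrow> ('j \<Rightarrow> 'a ugraph) \<Rightarrow> ('t \<Rightarrow> 'a set) \<Rightarrow> 't \<Rightarrow> 'j set" where
  "family_bag J H X t = {j \<in> J. verts (H j) \<inter> X t \<noteq> {}}"

lemma connected_family_bag:
  assumes td: "tree_decomposition G T X"
    and H: "subgraph H G" "connected_graph H"
  shows "connected_graph (induced_subgraph T {t \<in> verts T. verts H \<inter> X t \<noteq> {}})"
proof -
  \<comment> \<open>Reachability inside a node set, kept as a function of the set so that the
    subtree of one vertex can be compared with \<open>?S\<close>.\<close>
  define R where "R = (\<lambda>S. {(x, y). {x, y} \<in> edges (induced_subgraph T S)}\<^sup>*)"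
  let ?S = "{t \<in> verts T. verts H \<inter> X t \<noteq> {}}"
  have one: "(t, t') \<in> R ?S"
    if "u \<in> verts H" "t \<in> verts T" "t' \<in> verts T" "u \<in> X t" "u \<in> X t'" for u t t'
  proof -
    have "u \<in> verts G" using that(1) H(1) by (auto simp: subgraph_def)
    then have "(t, t') \<in> R {t \<in> verts T. u \<in> X t}"
      using td that by (simp add: tree_decomposition_def connected_graph_def induced_subgraph_def R_def)
    moreover have "R {t \<in> verts T. u \<in> X t} \<subseteq> R ?S"
      unfolding R_def by (rule rtrancl_mono) (use that(1) in \<open>auto simp: induced_subgraph_def\<close>)
    ultimately show ?thesis by blast
  qed
  \<comment> \<open>The end node \<open>t'\<close> stays arbitrary in the induction along the walk,
    because the node at which to leave the subtree of a vertex is known only once the next edge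
    is.\<close>
  have path: "(t, t') \<in> R ?S"
    if t: "t \<in> verts T" "u \<in> X t" "u \<in> verts H"
      and uv: "(u, v) \<in> {(x, y). {x, y} \<in> edges H}\<^sup>*"
      and t': "t' \<in> verts T" "v \<in> X t'" for u v t t'
    using uv t'
  proof (induction arbitrary: t' rule: rtrancl_induct)
    case base
    then show ?case using t one by blast
  next
    case (step y z)
    then have yz: "{y, z} \<in> edges H" by simp
    then have "{y, z} \<in> edges G" "y \<in> verts H" "z \<in> verts H"
      using H(1) by (auto simp: subgraph_def simple_graph_def)
    \<comment> \<open>The bag at \<open>r\<close> covers the edge: the induction hypothesis for
      \<open>y\<close> leads from \<open>t\<close> to \<open>r\<close>, and the subtree of
      \<open>z\<close> leads on to \<open>t'\<close>.\<close>
    moreover from this obtain r where r: "r \<in> verts T" "{y, z} \<subseteq> X r"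
      using td by (auto simp: tree_decomposition_def)
    ultimately have "(t, r) \<in> R ?S" "(r, t') \<in> R ?S"
      using step one by auto
    then show ?case unfolding R_def by (rule rtrancl_trans)
  qed
  show ?thesis
    unfolding connected_graph_def
  proof (intro ballI)
    fix t t' assume "t \<in> verts (induced_subgraph T ?S)" "t' \<in> verts (induced_subgraph T ?S)"
    then obtain u v where "t \<in> verts T" "u \<in> verts H" "u \<in> X t" "t' \<in> verts T" "v \<in> verts H" "v \<in> X t'"
      by (auto simp: induced_subgraph_def)
    moreover from this have "(u, v) \<in> {(x, y). {x, y} \<in> edges H}\<^sup>*"
      using H(2) by (simp add: connected_graph_def)
    ultimately show "(t, t') \<in> {(x, y). {x, y} \<in> edges (induced_subgraph T ?S)}\<^sup>*"
      using path unfolding R_def by blast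
  qed
qed

lemma tree_decomposition_family_graph:
  assumes td: "tree_decomposition G T X"
    and H: "\<And>j. j \<in> J \<Longrightarrow> subgraph (H j) G \<and> connected_graph (H j) \<and> nonnull (H j)"
  shows "tree_decomposition (family_graph G J H) T (family_bag J H X)"
  unfolding tree_decomposition_def
proof (intro conjI ballI)
  show "tree T" using td by (simp add: tree_decomposition_def)
next
  fix t show "family_bag J H X t \<subseteq> verts (family_graph G J H)"
    by (auto simp: family_bag_def family_graph_def)
next
  fix j assume "j \<in> verts (family_graph G J H)"
  then have j: "j \<in> J" by (simp add: family_graph_def)
  then obtain v where "v \<in> verts (H j)" "v \<in> verts G"
    using H by (fastforce simp: nonnull_def subgraph_def)
  then show "\<exists>t\<in>verts T. j \<in> family_bag J H X t"
    using td j by (fastforce simp: tree_decomposition_def family_bag_def)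
next
  fix e assume "e \<in> edges (family_graph G J H)"
  then obtain i j where e: "e = {i, j}" "i \<in> J" "j \<in> J"
    and adj: "verts (H i) \<inter> verts (H j) \<noteq> {} \<or>
      (\<exists>u\<in>verts (H i). \<exists>v\<in>verts (H j). {u, v} \<in> edges G)"
    unfolding family_graph_def by simp blast
  \<comment> \<open>Some bag meets both subgraphs: a bag covering an edge between them or, with
    \<open>u = v\<close>, any bag of a common vertex.\<close>
  obtain u v t where "u \<in> verts (H i)" "v \<in> verts (H j)" "t \<in> verts T" "u \<in> X t" "v \<in> X t"
  proof (cases "verts (H i) \<inter> verts (H j) = {}")
    case True
    then obtain u v where "u \<in> verts (H i)" "v \<in> verts (H j)" "{u, v} \<in> edges G"
      using adj by auto
    moreover from this obtain t where "t \<in> verts T" "{u, v} \<subseteq> X t"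
      using td by (auto simp: tree_decomposition_def)
    ultimately show ?thesis using that by blast
  next
    case False
    then obtain u where u: "u \<in> verts (H i)" "u \<in> verts (H j)" by auto
    then have "u \<in> verts G" using H e by (auto simp: subgraph_def)
    then obtain t where "t \<in> verts T" "u \<in> X t"
      using td by (auto simp: tree_decomposition_def)
    then show ?thesis using that u by blast
  qed
  then show "\<exists>t\<in>verts T. e \<subseteq> family_bag J H X t"
    using e by (auto simp: family_bag_def)
next
  fix j assume "j \<in> verts (family_graph G J H)"
  then have j: "j \<in> J" by (simp add: family_graph_def)
  then have "{t \<in> verts T. j \<in> family_bag J H X t} = {t \<in> verts T. verts (H j) \<inter> X t \<noteq> {}}"
    by (auto simp: family_bag_def)
  then show "connected_graph (induced_subgraph T {t \<in> verts T. j \<in> family_bag J H X t})"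
    using connected_family_bag[OF td] H[OF j] by simp
qed

section \<open>Comparison of the independence numbers\<close>

lemma finite_independent_cards:
  "finite (verts G) \<Longrightarrow> finite {card S | S. independent G S}"
  by (rule finite_subset[of _ "card ` Pow (verts G)"]) (auto simp: independent_def)

lemma independence_number_family_bag:
  assumes G: "simple_graph G" and "finite J" and V: "\<And>j. j \<in> J \<Longrightarrow> verts (H j) \<subseteq> verts G"
  shows "independence_number (induced_subgraph (family_graph G J H) (family_bag J H X t))
    \<le> independence_number (induced_subgraph G (X t))"
    (is "independence_number ?G' \<le> independence_number ?G")
proof -
  have "card S \<le> independence_number ?G" if S: "independent ?G' S" for S
  proof -
    have SJ: "S \<subseteq> family_bag J H X t" "S \<subseteq> J"
      using S by (auto simp: independent_def induced_subgraph_def family_bag_def)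
    \<comment> \<open>A representative of each index inside the old bag; it exists by the definition
      of \<open>family_bag\<close>.\<close>
    define f where "f = (\<lambda>j. SOME v. v \<in> verts (H j) \<inter> X t)"
    have f: "f j \<in> verts (H j)" "f j \<in> X t" if "j \<in> S" for j
      using that SJ some_in_eq[of "verts (H j) \<inter> X t"] by (auto simp: f_def family_bag_def)
    have nadj: "f i \<noteq> f j \<and> {f i, f j} \<notin> edges G" if "i \<in> S" "j \<in> S" "i \<noteq> j" for i j
    proof -
      have "{i, j} \<notin> edges (family_graph G J H)"
        using S that SJ(1) unfolding independent_def induced_subgraph_def by simp blast
      moreover have "i \<in> J" "j \<in> J" using that SJ(2) by auto
      ultimately have "\<not> (verts (H i) \<inter> verts (H j) \<noteq> {} \<or>
          (\<exists>u\<in>verts (H i). \<exists>v\<in>verts (H j). {u, v} \<in> edges G))"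
        using that(3) unfolding family_graph_def by simp blast
      then show ?thesis
        using f(1)[OF that(1)] f(1)[OF that(2)] by auto
    qed
    then have "inj_on f S" by (auto simp: inj_on_def)
    then have "card S = card (f ` S)" by (simp add: card_image)
    moreover have "independent ?G (f ` S)"
    proof -
      \<comment> \<open>Independence also quantifies over equal vertices, so loops have to be
        excluded: \<open>{x, x}\<close> has only one element.\<close>
      have "{x, x} \<notin> edges G" for x
        using G by (force simp: simple_graph_def)
      then have "{f i, f j} \<notin> edges G" if "i \<in> S" "j \<in> S" for i j
        using nadj[OF that] by (cases "i = j") auto
      then show ?thesis
        using f V SJ(2) unfolding independent_def induced_subgraph_def by simp blast
    qed
    moreover have "finite (verts ?G)"
      using G by (simp add: simple_graph_def induced_subgraph_def)
    ultimately show ?thesis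
      unfolding independence_number_def
      by (intro Max_ge finite_independent_cards) blast+
  qed
  moreover have "finite (verts ?G')"
    using \<open>finite J\<close> by (simp add: induced_subgraph_def family_graph_def)
  \<comment> \<open>The maximum is taken over a nonempty set.\<close>
  moreover have "independent ?G' {}" by (simp add: independent_def)
  ultimately show ?thesis
    unfolding independence_number_def[of ?G']
    by (intro Max.boundedI finite_independent_cards) auto
qed

lemma td_independence_number_family_graph:
  assumes "simple_graph G" "finite J" "\<And>j. j \<in> J \<Longrightarrow> verts (H j) \<subseteq> verts G" "tree T"
  shows "td_independence_number (family_graph G J H) T (family_bag J H X) \<le> td_independence_number G T X"
proof -
  have T: "finite (verts T)" "verts T \<noteq> {}"
    using \<open>tree T\<close> by (auto simp: tree_def simple_graph_def nonnull_def)
  have "independence_number (induced_subgraph (family_graph G J H) (family_bag J H X t))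
      \<le> td_independence_number G T X" if "t \<in> verts T" for t
  proof -
    have "independence_number (induced_subgraph (family_graph G J H) (family_bag J H X t))
        \<le> independence_number (induced_subgraph G (X t))"
      using assms by (intro independence_number_family_bag) auto
    also have "\<dots> \<le> td_independence_number G T X"
      unfolding td_independence_number_def using T that by (intro Max_ge) auto
    finally show ?thesis .
  qed
  then show ?thesis
    unfolding td_independence_number_def[of "family_graph G J H"]
    using T by (intro Max.boundedI) auto
qed

section \<open>The complete program and its running time\<close>

lemma edges_family_graph_ordered:
  assumes E: "bij_betw (\<lambda>e. {a e, b e}) {..<m} (edges G)"
  shows "edges (family_graph G {..<k :: nat} H) = {{i, j} | i j. i < j \<and> j < k \<and>
    verts (H i) \<inter> {x. x \<in> verts (H j) \<or>
      (\<exists>e<m. a e \<in> verts (H j) \<and> b e = x \<or> b e \<in> verts (H j) \<and> a e = x)} \<noteq> {}}"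
proof -
  define adj where "adj = (\<lambda>i j. verts (H i) \<inter> verts (H j) \<noteq> {} \<or>
    (\<exists>u\<in>verts (H i). \<exists>v\<in>verts (H j). {u, v} \<in> edges G))"
  let ?hit = "\<lambda>i j. verts (H i) \<inter> {x. x \<in> verts (H j) \<or>
      (\<exists>e<m. a e \<in> verts (H j) \<and> b e = x \<or> b e \<in> verts (H j) \<and> a e = x)} \<noteq> {}"
  \<comment> \<open>The edge list stores the two ends in arbitrary order.\<close>
  have mem: "{u, v} \<in> edges G \<longleftrightarrow> (\<exists>e<m. a e = v \<and> b e = u \<or> b e = v \<and> a e = u)" for u v
  proof -
    have "edges G = (\<lambda>e. {a e, b e}) ` {..<m}"
      using E by (simp add: bij_betw_def)
    then show ?thesis by (auto simp: doubleton_eq_iff)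
  qed
  have hit: "adj i j \<longleftrightarrow> ?hit i j" for i j
  proof -
    have "?hit i j \<longleftrightarrow> verts (H i) \<inter> verts (H j) \<noteq> {} \<or> (\<exists>u\<in>verts (H i). \<exists>e<m.
        a e \<in> verts (H j) \<and> b e = u \<or> b e \<in> verts (H j) \<and> a e = u)"
      by blast
    also have "(\<exists>u\<in>verts (H i). \<exists>e<m. a e \<in> verts (H j) \<and> b e = u \<or> b e \<in> verts (H j) \<and> a e = u)
        \<longleftrightarrow> (\<exists>u\<in>verts (H i). \<exists>v\<in>verts (H j). {u, v} \<in> edges G)"
      unfolding mem by metis
    finally show ?thesis by (simp only: adj_def)
  qed
  \<comment> \<open>By symmetry every edge can be written with its smaller index first, the form in
    which the program finds it.\<close>
  have "adj j i" if "adj i j" for i j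
    using that unfolding adj_def by (metis Int_commute insert_commute)
  then have "{{i, j} | i j. i < k \<and> j < k \<and> i \<noteq> j \<and> adj i j} = {{i, j} | i j. i < j \<and> j < k \<and> adj i j}"
    (is "?L = ?R")
  proof (intro equalityI subsetI)
    fix e assume "e \<in> ?L"
    then obtain i j where e: "e = {i, j}" "i < k" "j < k" "i \<noteq> j" "adj i j" by blast
    show "e \<in> ?R"
    proof (cases "i < j")
      case False
      then have "j < i" "adj j i" "e = {j, i}"
        using e \<open>\<And>i j. adj i j \<Longrightarrow> adj j i\<close> by auto
      then show ?thesis using e(2) by blast
    qed (use e in blast)
  next
    fix e assume "e \<in> ?R"
    then obtain i j where e: "e = {i, j}" "i < j" "j < k" "adj i j" by blast
    then have "i < k" "i \<noteq> j" by auto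
    then show "e \<in> ?L" using e by blast
  qed
  moreover have "edges (family_graph G {..<k} H) = {{i, j} | i j. i < k \<and> j < k \<and> i \<noteq> j \<and> adj i j}"
    by (simp add: family_graph_def adj_def)
  ultimately show ?thesis
    by (simp only: hit)
qed

text \<open>Here \<open>N\<close> and \<open>M\<close> count the vertices and edges of the graph. By
  positivity, each term without \<open>M\<close> is at most a multiple of \<open>J * J * N\<close>
  or \<open>J * T * N\<close>. The final 2 pays for the test for empty \<open>J\<close> and the last
  copy.\<close>

lemma time_bound:
  fixes J T N M :: nat
  assumes "0 < J" "0 < T" "0 < N"
  shows "1 + J * (18 + 8 * N + M * 10 + J * (12 + 6 * N)) +
      (1 + T * (12 + 4 * N + J * (11 + 6 * N))) + 2
    \<le> 100 * (J * ((J + T) * N + M))"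
proof -
  \<comment> \<open>After this substitution all monomials have natural coefficients that can be
    compared one by one.\<close>
  obtain j t n where "J = Suc j" "T = Suc t" "N = Suc n"
    using assms by (metis gr0_implies_Suc)
  then show ?thesis by (simp add: algebra_simps)
qed

text \<open>For empty \<open>J\<close> the time bound is constant and does not allow for a loop over
  the nodes of the tree, hence the test. The copy stores the number of vertices of the output
  graph.\<close>

definition family_program :: com where
  "family_program =
     IfLess 22 2 (Seq family_edges (Seq family_bags (Copy 5 2))) Skip"

lemma run_family_program:
  assumes G: "simple_graph G" and fin: "finite J"
    and H: "\<And>j. j \<in> J \<Longrightarrow> subgraph (H j) G \<and> connected_graph (H j) \<and> nonnull (H j)"
    and td: "tree_decomposition G T X"
    and inp: "input_state s G J H T X"
  shows "run family_program s (\<lambda>n s'.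
    n \<le> 100 * max 1 (card J * ((card J + card (verts T)) * card (verts G) + card (edges G))) \<and>
    output_state s' (family_graph G J H) T (family_bag J H X))"
proof -
  have J: "J = {..<reg s 2}" and V: "sets_at s (reg s 2) 2 3 (\<lambda>j. verts (H j))"
    and VG: "verts G = {..<reg s 0}"
    and E: "bij_betw (\<lambda>e. {arr s 0 e, arr s 1 e}) {..<reg s 1} (edges G)"
    and T: "graph_at s 3 4 7 8 T" and VT: "verts T = {..<reg s 3}"
    and X: "sets_at s (reg s 3) 9 10 X"
    and zero: "\<And>r. 5 \<le> r \<Longrightarrow> reg s r = 0" "\<And>a i. 11 \<le> a \<Longrightarrow> arr s a i = 0"
    using inp by (auto simp: input_state_def graph_at_def)
  have card: "card J = reg s 2" "card (verts T) = reg s 3" "card (verts G) = reg s 0"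
    "card (edges G) = reg s 1"
    using J VT VG bij_betw_same_card[OF E] by simp_all
  have finG: "finite (verts G)" using G by (simp add: simple_graph_def)
  show ?thesis
  proof (cases "reg s 2 = 0")
    case True
    \<comment> \<open>Zeros encode the null graph, and offsets that are all 0 encode empty
      bags.\<close>
    have "output_state s (family_graph G J H) T (family_bag J H X)"
      using True J T zero by (auto simp: output_state_def graph_at_def family_graph_def
          sets_at_def offsets_at_def segment_def family_bag_def bij_betw_def)
    then show ?thesis
      using True by (simp add: family_program_def zero(1))
  next
    case False
    then have J0: "0 \<in> J" using J by simp
    have N0: "0 < reg s 0"
      using H[OF J0] VG by (fastforce simp: nonnull_def subgraph_def)
    have T0: "0 < reg s 3"
      using td VT by (fastforce simp: tree_decomposition_def tree_def nonnull_def)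
    have cardV: "card (verts (H j)) \<le> reg s 0" if "j < reg s 2" for j
      using H[of j] that J card_mono[OF finG, of "verts (H j)"] card(3) by (simp add: subgraph_def)
    have cardX: "card (X t) \<le> reg s 0" if "t < reg s 3" for t
      using td that VT card_mono[OF finG, of "X t"] card(3) by (simp add: tree_decomposition_def)
    have bag: "family_bag J H X = (\<lambda>t. {j. j < reg s 2 \<and> verts (H j) \<inter> X t \<noteq> {}})"
      using J by (auto simp: family_bag_def fun_eq_iff)
    let ?B = "100 * (card J * ((card J + card (verts T)) * card (verts G) + card (edges G)))"
    let ?B1 = "1 + reg s 2 * (18 + 8 * reg s 0 + reg s 1 * 10 + reg s 2 * (12 + 6 * reg s 0))"
    let ?B2 = "1 + reg s 3 * (12 + 4 * reg s 0 + reg s 2 * (11 + 6 * reg s 0))"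
    let ?Q = "\<lambda>n s'. n \<le> ?B \<and> output_state s' (family_graph G J H) T (family_bag J H X)"
    have B: "?B1 + ?B2 + 2 \<le> ?B"
      unfolding card using False T0 N0 by (intro time_bound) auto
    have "run family_edges s (\<lambda>n s'. n \<le> ?B1 \<and>
      bij_betw (\<lambda>e. {arr s' 11 e, arr s' 12 e}) {..<reg s' 6} (edges (family_graph G J H)))"
      unfolding J edges_family_graph_ordered[OF E]
      using V cardV by (intro run_family_edges) (simp_all add: zero)
    then have "run family_edges s (\<lambda>m t. run family_bags t
      (\<lambda>n t'. ?Q (1 + (m + (n + 1))) (set_reg 5 (reg t' 2) t')))"
    proof (rule run_conseq)
      fix m t
      assume Q: "m \<le> ?B1 \<and>
        bij_betw (\<lambda>e. {arr t 11 e, arr t 12 e}) {..<reg t 6} (edges (family_graph G J H))"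
        and "frame family_edges s t"
      \<comment> \<open>The second phase starts from zeros in registers 22 to 24, array 17 and
        offset 0 of array 13, none of which the first phase writes.\<close>
      then have f: "reg t 2 = reg s 2" "reg t 3 = reg s 3" "reg t 4 = reg s 4"
        "reg t 22 = 0" "reg t 23 = 0" "reg t 24 = 0"
        "\<And>a. a < 11 \<Longrightarrow> arr t a = arr s a" "\<And>x. arr t 13 x = 0" "\<And>x. arr t 17 x = 0"
        using zero by (simp_all add: frame_def)
      have "run family_bags t
        (\<lambda>n s'. n \<le> 1 + reg t 3 * (12 + 4 * reg s 0 + reg t 2 * (11 + 6 * reg s 0)) \<and>
          sets_at s' (reg t 3) 13 14 (\<lambda>u. {j. j < reg t 2 \<and> verts (H j) \<inter> X u \<noteq> {}}))"
        using V X cardV cardX f by (intro run_family_bags) (simp_all add: sets_at_cong[of t _ s])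
      then show "run family_bags t (\<lambda>n t'. ?Q (1 + (m + (n + 1))) (set_reg 5 (reg t' 2) t'))"
      proof (rule run_conseq)
        fix n t'
        assume Q': "n \<le> 1 + reg t 3 * (12 + 4 * reg s 0 + reg t 2 * (11 + 6 * reg s 0)) \<and>
          sets_at t' (reg t 3) 13 14 (\<lambda>u. {j. j < reg t 2 \<and> verts (H j) \<inter> X u \<noteq> {}})"
          and "frame family_bags t t'"
        then have f': "reg t' 2 = reg s 2" "reg t' 3 = reg s 3" "reg t' 4 = reg s 4" "reg t' 6 = reg t 6"
          "\<And>a. a < 11 \<Longrightarrow> arr t' a = arr s a" "arr t' 11 = arr t 11" "arr t' 12 = arr t 12"
          using f by (simp_all add: frame_def)
        let ?t = "set_reg 5 (reg t' 2) t'"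
        have "1 + (m + (n + 1)) \<le> ?B1 + ?B2 + 2"
          using Q Q' f by simp
        then have "1 + (m + (n + 1)) \<le> ?B"
          using B by (rule order_trans)
        moreover have "graph_at ?t 5 6 11 12 (family_graph G J H)"
          using Q f' J by (simp add: graph_at_def family_graph_def)
        moreover have "graph_at ?t 3 4 7 8 T"
          using T f' by (simp add: graph_at_def)
        moreover have "sets_at ?t (reg ?t 3) 13 14 (family_bag J H X)"
          using Q' f f' sets_at_cong[of ?t 13 t' 14] by (simp add: bag)
        ultimately show "?Q (1 + (m + (n + 1))) ?t"
          by (simp add: output_state_def)
      qed
    qed
    then have "run family_program s ?Q"
      using False zero(1)[of 22] by (simp add: family_program_def)
    then show ?thesis
      by (rule run_conseq) (auto intro: order_trans)
  qed
qed

theorem corollary6p4: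
  shows "\<exists>(P :: com) (c :: nat).
    \<forall>(G :: nat ugraph) (J :: nat set) (H :: nat \<Rightarrow> nat ugraph) (T :: nat ugraph)
      (X :: nat \<Rightarrow> nat set) (s :: state).
      simple_graph G \<and> finite J \<and>
      (\<forall>j\<in>J. subgraph (H j) G \<and> connected_graph (H j) \<and> nonnull (H j)) \<and>
      tree_decomposition G T X \<and>
      input_state s G J H T X \<longrightarrow>
      (\<exists>n s' X'.
        exec P s n s' \<and>
        n \<le> c * max 1 (card J * ((card J + card (verts T)) * card (verts G) + card (edges G))) \<and>
        output_state s' (family_graph G J H) T X' \<and>
        tree_decomposition (family_graph G J H) T X' \<and>
        td_independence_number (family_graph G J H) T X' \<le> td_independence_number G T X)"
proof (rule exI[of _ family_program], rule exI[of _ 100], intro allI impI)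
  fix G T :: "nat ugraph" and J :: "nat set" and H :: "nat \<Rightarrow> nat ugraph"
    and X :: "nat \<Rightarrow> nat set" and s :: state
  assume A: "simple_graph G \<and> finite J \<and>
      (\<forall>j\<in>J. subgraph (H j) G \<and> connected_graph (H j) \<and> nonnull (H j)) \<and>
      tree_decomposition G T X \<and> input_state s G J H T X"
  have "run family_program s (\<lambda>n s'.
    n \<le> 100 * max 1 (card J * ((card J + card (verts T)) * card (verts G) + card (edges G))) \<and>
    output_state s' (family_graph G J H) T (family_bag J H X))"
    using A by (intro run_family_program) auto
  moreover have "tree_decomposition (family_graph G J H) T (family_bag J H X)"
    using A by (intro tree_decomposition_family_graph) auto
  moreover have "td_independence_number (family_graph G J H) T (family_bag J H X)
      \<le> td_independence_number G T X"
    using A by (intro td_independence_number_family_graph)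
      (auto simp: subgraph_def tree_decomposition_def)
  ultimately show "\<exists>n s' X'. exec family_program s n s' \<and>
        n \<le> 100 * max 1 (card J * ((card J + card (verts T)) * card (verts G) + card (edges G))) \<and>
        output_state s' (family_graph G J H) T X' \<and>
        tree_decomposition (family_graph G J H) T X' \<and>
        td_independence_number (family_graph G J H) T X' \<le> td_independence_number G T X"
    unfolding run_def by blast
qed

end
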